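(* Let $\mathcal{F}:\mathcal{P}_2(\mathbf{R}^d)\to\mathbf{R}$ be a functional with gradient $\mathcal{G}_{\mathcal{F}}$, let $L>0$, and assume that $\mathcal{F}$ is transport convex and transport $L$-smooth. Let $\mu_*\in\mathcal{P}_2(\mathbf{R}^d)$ be a minimizer of $\mathcal{F}$ over $\mathcal{P}_2(\mathbf{R}^d)$, let $\mu_0\in\mathcal{P}_2(\mathbf{R}^d)$, and assume that $\mu_*=(X_* )_\#\mu_0$ for some map $X_*\in L^2(\mathbf{R}^d\to\mathbf{R}^d)$. Put $$a_n:=\frac{(n+1)(n+2)}{16L}\qquad(n=0,1,2,\ldots),$$ and define maps $X_n^{\mathrm{ac}},Y_n^{\mathrm{ac}},Z_n^{\mathrm{ac}}:\mathbf{R}^d\to\mathbf{R}^d$ by $X_0^{\mathrm{ac}}(x)=Y_0^{\mathrm{ac}}(x)=Z_0^{\mathrm{ac}}(x)=x$ and, for $n\ge 0$, $$X_{n+1}^{\mathrm{ac}}(x)=Y_n^{\mathrm{ac}}(x)+\frac{a_{n+1}-a_n}{a_{n+1}}\,(Z_n^{\mathrm{ac}}(x)-Y_n^{\mathrm{ac}}(x)),$$ $$Z_{n+1}^{\mathrm{ac}}(x)=Z_n^{\mathrm{ac}}(x)-(a_{n+1}-a_n)\,\mathcal{G}_{\mathcal{F}}[(X_{n+1}^{\mathrm{ac}})_\#\mu_0](X_{n+1}^{\mathrm{ac}}(x)),$$ $$Y_{n+1}^{\mathrm{ac}}(x)=X_{n+1}^{\mathrm{ac}}(x)-\frac1L\,\mathcal{G}_{\mathcal{F}}[(X_{n+1}^{\mathrm{ac}})_\#\mu_0](X_{n+1}^{\mathrm{ac}}(x)).$$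 Let $\hat\nu_n^{\mathrm{ac}}:=(Y_n^{\mathrm{ac}})_\#\mu_0$. Then $\mathcal{F}(\hat\nu_n^{\mathrm{ac}})-\mathcal{F}(\mu_* )=\mathrm{O}(1/n^2)$ as $n\to\infty$.
   Context: $\mathcal{P}_2(\mathbf{R}^d)$ is the set of probability measures on $\mathbf{R}^d$ with finite second-order moment; $\|\cdot\|$ and $\langle\cdot,\cdot\rangle$ are the Euclidean norm and inner product; $F_\#\mu$ is the push-forward of $\mu$ by $F$; integrals are over $\mathbf{R}^d$. $L^2(\mathbf{R}^d\to\mathbf{R}^d)$ is the set of maps $\mathbf{R}^d\to\mathbf{R}^d$ that are square integrable with respect to the base measure being pushed forward ($\mu$ in the definitions below, $\mu_0$ for $X_*$). All push-forward measures at which $\mathcal{F}$ or $\mathcal{G}_{\mathcal{F}}$ is evaluated are understood to lie in $\mathcal{P}_2(\mathbf{R}^d)$. Gradient: a function $\mathcal{G}_{\mathcal{F}}[\cdot](\cdot):\mathcal{P}_2(\mathbf{R}^d)\times\mathbf{R}^d\to\mathbf{R}^d$ is a gradient of $\mathcal{F}$ if for every $\mu_0\in\mathcal{P}_2(\mathbf{R}^d)$ and every $X:[0,\infty)\times\mathbf{R}^d\to\mathbf{R}^d$ differentiable in the first variable, with $\mu_t:=X(t,\cdot)_\#\mu_0$, one has $\frac{\mathrm{d}}{\mathrm{d}t}\mathcal{F}(\mu_t)=\int\langle\mathcal{G}_{\mathcal{F}}[\mu_t](X(t,x)),\frac{\partial}{\partial t}X(t,x)\rangle\,\mathrm{d}\mu_0(x)$.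 Transport convex: $\mathcal{F}(T_\#\mu)-\mathcal{F}(S_\#\mu)\ge\int\langle\mathcal{G}_{\mathcal{F}}[S_\#\mu](S(x)),T(x)-S(x)\rangle\,\mathrm{d}\mu(x)$ for any $S,T\in L^2(\mathbf{R}^d\to\mathbf{R}^d)$ and $\mu\in\mathcal{P}_2(\mathbf{R}^d)$. Transport $L$-smooth: $\mathcal{F}(T_\#\mu)-\mathcal{F}(S_\#\mu)\le\int\langle\mathcal{G}_{\mathcal{F}}[S_\#\mu](S(x)),T(x)-S(x)\rangle\,\mathrm{d}\mu(x)+\frac L2\int\|T(x)-S(x)\|^2\,\mathrm{d}\mu(x)$ for any $S,T\in L^2(\mathbf{R}^d\to\mathbf{R}^d)$ and $\mu\in\mathcal{P}_2(\mathbf{R}^d)$. *)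

theory Defs
  imports "HOL-Probability.Probability" "HOL-Library.Landau_Symbols"
begin

definition P2 :: "'a::euclidean_space measure set" where
  "P2 = {\<mu>. sets \<mu> = sets borel \<and> prob_space \<mu> \<and> integrable \<mu> (\<lambda>x. (norm x)\<^sup>2)}"

definition L2 :: "'a::euclidean_space measure \<Rightarrow> ('a \<Rightarrow> 'a) set" where
  "L2 \<mu> = {f. f \<in> borel_measurable \<mu> \<and> integrable \<mu> (\<lambda>x. (norm (f x))\<^sup>2)}"

abbreviation push :: "('a::euclidean_space \<Rightarrow> 'a) \<Rightarrow> 'a measure \<Rightarrow> 'a measure" where
  "push f \<mu> \<equiv> distr \<mu> borel f"

text \<open>
  \<open>L2_curve \<mu>0 X D\<close>: \<open>X\<close> is differentiable in time on \<open>[0,\<infinity>)\<close> (one-sidedly at \<open>0\<close>) with time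
  derivative \<open>D\<close>, both pointwise in space and in the mean square sense. The condition
  \<open>X t \<in> L2 \<mu>0\<close> says that the push-forward of \<open>\<mu>0\<close> by \<open>X t\<close> lies in \<open>P2\<close>.

  The mean square part is what makes the chain rule in \<open>is_gradient\<close> a reasonable demand: for
  pointwise differentiability alone, differentiation and integration need not commute. For
  instance, take \<open>\<mu>0\<close> uniform on \<open>[0,1]\<close>, a bump \<open>\<phi>\<close> supported in \<open>[-1/2,1/2]\<close>,
  \<open>X t x = x + \<phi> (x / t - 1) * v\<close> for \<open>t > 0\<close>, and \<open>X 0 x = x\<close>. Every point has velocity \<open>0\<close> at
  time \<open>0\<close>, but \<open>\<integral>V (X t x) d\<mu>0\<close> in general has a nonzero derivative there.
\<close>
definition L2_curve ::
    "'a::euclidean_space measure \<Rightarrow> (real \<Rightarrow> 'a \<Rightarrow> 'a) \<Rightarrow> (real \<Rightarrow> 'a \<Rightarrow> 'a) \<Rightarrow> bool" where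
  "L2_curve \<mu>0 X D \<longleftrightarrow> (\<forall>t\<ge>0.
     X t \<in> L2 \<mu>0 \<and> D t \<in> L2 \<mu>0 \<and>
     (\<forall>x. ((\<lambda>s. X s x) has_vector_derivative D t x) (at t within {0..})) \<and>
     ((\<lambda>s. \<integral>x. (norm ((X s x - X t x) /\<^sub>R (s - t) - D t x))\<^sup>2 \<partial>\<mu>0) \<longlongrightarrow> 0) (at t within {0..}))"

text \<open>
  The Bochner integral of a non-integrable function is \<open>0\<close>, so existence of the integral is
  demanded explicitly. Applied to \<open>X t x = S x + t *\<^sub>R (T x - S x)\<close> at \<open>t = 0\<close>, this also yields
  the existence of the inner product integrals in the two definitions after it.
\<close>
definition is_gradient ::
    "('a::euclidean_space measure \<Rightarrow> real) \<Rightarrow> ('a measure \<Rightarrow> 'a \<Rightarrow> 'a) \<Rightarrow> bool" where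
  "is_gradient F G \<longleftrightarrow> (\<forall>\<mu>0\<in>P2. \<forall>X D. L2_curve \<mu>0 X D \<longrightarrow> (\<forall>t\<ge>0.
     integrable \<mu>0 (\<lambda>x. G (push (X t) \<mu>0) (X t x) \<bullet> D t x) \<and>
     ((\<lambda>s. F (push (X s) \<mu>0)) has_real_derivative
        (\<integral>x. G (push (X t) \<mu>0) (X t x) \<bullet> D t x \<partial>\<mu>0)) (at t within {0..})))"

text \<open>A chain rule for all pointwise differentiable curves is sufficient.\<close>
lemma is_gradient_if_pointwise:
  assumes "\<And>\<mu>0 X D t. \<lbrakk>\<mu>0 \<in> P2; \<forall>t\<ge>0. X t \<in> L2 \<mu>0;
       \<forall>t\<ge>0. \<forall>x. ((\<lambda>s. X s x) has_vector_derivative D t x) (at t within {0..}); t \<ge> 0\<rbrakk> \<Longrightarrow>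
     integrable \<mu>0 (\<lambda>x. G (push (X t) \<mu>0) (X t x) \<bullet> D t x) \<and>
     ((\<lambda>s. F (push (X s) \<mu>0)) has_real_derivative
        (\<integral>x. G (push (X t) \<mu>0) (X t x) \<bullet> D t x \<partial>\<mu>0)) (at t within {0..})"
  shows "is_gradient F G"
  unfolding is_gradient_def L2_curve_def by (intro ballI allI impI assms) auto

definition transport_convex ::
    "('a::euclidean_space measure \<Rightarrow> real) \<Rightarrow> ('a measure \<Rightarrow> 'a \<Rightarrow> 'a) \<Rightarrow> bool" where
  "transport_convex F G \<longleftrightarrow> (\<forall>\<mu>\<in>P2. \<forall>S\<in>L2 \<mu>. \<forall>T\<in>L2 \<mu>.
     F (push T \<mu>) - F (push S \<mu>) \<ge> (\<integral>x. G (push S \<mu>) (S x) \<bullet> (T x - S x) \<partial>\<mu>))"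

definition transport_smooth ::
    "real \<Rightarrow> ('a::euclidean_space measure \<Rightarrow> real) \<Rightarrow> ('a measure \<Rightarrow> 'a \<Rightarrow> 'a) \<Rightarrow> bool" where
  "transport_smooth L F G \<longleftrightarrow> (\<forall>\<mu>\<in>P2. \<forall>S\<in>L2 \<mu>. \<forall>T\<in>L2 \<mu>.
     F (push T \<mu>) - F (push S \<mu>) \<le> (\<integral>x. G (push S \<mu>) (S x) \<bullet> (T x - S x) \<partial>\<mu>)
       + L / 2 * (\<integral>x. (norm (T x - S x))\<^sup>2 \<partial>\<mu>))"

end

theory Submission
  imports Defs
begin

text \<open>
  The pull-backs \<open>G (push S \<mu>0) \<circ> S\<close> play the role of gradients in the Hilbert space
  \<open>L2 \<mu>0\<close>, where \<open>S \<mapsto> F (push S \<mu>0)\<close> is convex and smooth, and the scheme is Nesterov's method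
  for this function. The energy \<open>a n * (F (push (Y n) \<mu>0) - F \<mu>star) + 1/2 * \<parallel>Z n - Xstar\<parallel>\<^sup>2\<close>
  is nonincreasing because \<open>(a (n+1) - a n)\<^sup>2 \<le> a (n+1) / L\<close>. That the gradients belong to
  \<open>L2 \<mu>0\<close> is not part of the definition of a gradient; it follows from smoothness and the
  boundedness of \<open>F\<close> from below by comparing \<open>S\<close> with a step along the truncated gradient.
\<close>

section \<open>Square integrable maps\<close>

lemma L2_measurable: "f \<in> L2 \<mu> \<Longrightarrow> f \<in> borel_measurable \<mu>"
  and L2_integrable: "f \<in> L2 \<mu> \<Longrightarrow> integrable \<mu> (\<lambda>x. (norm (f x))\<^sup>2)"
  by (auto simp: L2_def)

lemma L2_inner_integrable:
  assumes "f \<in> L2 \<mu>" "g \<in> L2 \<mu>"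
  shows "integrable \<mu> (\<lambda>x. f x \<bullet> g x)"
proof (rule Bochner_Integration.integrable_bound)
  show "integrable \<mu> (\<lambda>x. (norm (f x))\<^sup>2 + (norm (g x))\<^sup>2)"
    using assms by (intro Bochner_Integration.integrable_add L2_integrable)
  show "(\<lambda>x. f x \<bullet> g x) \<in> borel_measurable \<mu>"
    using assms by (intro borel_measurable_inner L2_measurable)
  have "\<bar>u \<bullet> v\<bar> \<le> (norm u)\<^sup>2 + (norm v)\<^sup>2" for u v :: 'a
  proof -
    have "\<bar>u \<bullet> v\<bar> \<le> norm u * norm v"
      by (rule Cauchy_Schwarz_ineq2)
    also have "\<dots> \<le> 2 * norm u * norm v"
      by simp
    also have "\<dots> \<le> (norm u)\<^sup>2 + (norm v)\<^sup>2"
      by (rule sum_squares_bound)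
    finally show ?thesis .
  qed
  then show "AE x in \<mu>. norm (f x \<bullet> g x) \<le> norm ((norm (f x))\<^sup>2 + (norm (g x))\<^sup>2)"
    by simp
qed

lemma L2_scaleR:
  assumes "f \<in> L2 \<mu>"
  shows "(\<lambda>x. c *\<^sub>R f x) \<in> L2 \<mu>"
  using assms by (auto simp: L2_def power_mult_distrib)

lemma L2_add:
  assumes "f \<in> L2 \<mu>" "g \<in> L2 \<mu>"
  shows "(\<lambda>x. f x + g x) \<in> L2 \<mu>"
proof -
  have "integrable \<mu> (\<lambda>x. (norm (f x))\<^sup>2 + 2 * (f x \<bullet> g x) + (norm (g x))\<^sup>2)"
    by (intro Bochner_Integration.integrable_add integrable_mult_right
        L2_inner_integrable L2_integrable assms)
  moreover have "(norm (u + v))\<^sup>2 = (norm u)\<^sup>2 + 2 * (u \<bullet> v) + (norm v)\<^sup>2" for u v :: 'a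
    by (simp add: power2_norm_eq_inner inner_add_left inner_add_right inner_commute)
  ultimately show ?thesis
    using assms by (auto simp: L2_def)
qed

lemma L2_diff:
  assumes "f \<in> L2 \<mu>" "g \<in> L2 \<mu>"
  shows "(\<lambda>x. f x - g x) \<in> L2 \<mu>"
  using L2_add[OF assms(1) L2_scaleR[OF assms(2), of "-1"]] by simp

lemma L2_bounded:
  assumes "finite_measure \<mu>" "f \<in> borel_measurable \<mu>" "\<And>x. norm (f x) \<le> B"
  shows "f \<in> L2 \<mu>"
proof -
  interpret finite_measure \<mu> by fact
  have "integrable \<mu> (\<lambda>x. (norm (f x))\<^sup>2)"
    by (rule integrable_const_bound[where B = "B\<^sup>2"])
      (use assms in \<open>auto intro!: power_mono\<close>)
  with assms(2) show ?thesis by (simp add: L2_def)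
qed

lemma P2_finite_measure: "\<mu> \<in> P2 \<Longrightarrow> finite_measure \<mu>"
  by (simp add: P2_def prob_space.finite_measure)

lemma L2_id: "\<mu> \<in> P2 \<Longrightarrow> (\<lambda>x. x) \<in> L2 \<mu>"
  by (auto simp: P2_def L2_def intro: measurable_ident_sets)

lemma push_in_P2:
  assumes "\<mu> \<in> P2" "S \<in> L2 \<mu>"
  shows "push S \<mu> \<in> P2"
proof -
  have "S \<in> measurable \<mu> borel" using assms(2) by (simp add: L2_measurable)
  then show ?thesis
    using assms by (auto simp: P2_def L2_def prob_space.prob_space_distr integrable_distr_eq)
qed

section \<open>Regularity of the pulled-back gradient\<close>

lemma L2_curve_line:
  assumes "S \<in> L2 \<mu>" "D \<in> L2 \<mu>"
  shows "L2_curve \<mu> (\<lambda>t x. S x + t *\<^sub>R D x) (\<lambda>_. D)"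
  unfolding L2_curve_def
proof (intro allI impI conjI)
  fix t :: real assume "t \<ge> 0"
  show "(\<lambda>x. S x + t *\<^sub>R D x) \<in> L2 \<mu>"
    by (intro L2_add L2_scaleR assms)
  show "D \<in> L2 \<mu>" by fact
  show "((\<lambda>s. S x + s *\<^sub>R D x) has_vector_derivative D x) (at t within {0..})" for x
    by (auto intro!: derivative_eq_intros)
  \<comment> \<open>The difference quotient of a straight line is exactly \<open>D x\<close>. At
    \<open>s = t\<close> division by zero would leave \<open>- D x\<close>, but the filter excludes
    that point.\<close>
  have "((S x + s *\<^sub>R D x - (S x + t *\<^sub>R D x)) /\<^sub>R (s - t) - D x) = 0" if "s \<noteq> t" for s x
    using that by (simp flip: scaleR_diff_left)
  then have "\<forall>\<^sub>F s in at t within {0..}.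
      (\<integral>x. (norm ((S x + s *\<^sub>R D x - (S x + t *\<^sub>R D x)) /\<^sub>R (s - t) - D x))\<^sup>2 \<partial>\<mu>) = 0"
    by (auto simp: eventually_at_filter)
  then show "((\<lambda>s. \<integral>x. (norm ((S x + s *\<^sub>R D x - (S x + t *\<^sub>R D x)) /\<^sub>R (s - t) - D x))\<^sup>2 \<partial>\<mu>)
      \<longlongrightarrow> 0) (at t within {0..})"
    by (rule tendsto_eventually)
qed

text \<open>The chain rule along the line from \<open>S\<close> in direction \<open>D\<close>, read
  at time 0, where the curve passes through \<open>S\<close>. Only its integrability half is
  taken.\<close>

lemma gradient_inner_integrable:
  assumes "is_gradient F G" "\<mu> \<in> P2" "S \<in> L2 \<mu>" "D \<in> L2 \<mu>"
  shows "integrable \<mu> (\<lambda>x. G (push S \<mu>) (S x) \<bullet> D x)"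
  using assms(1)[unfolded is_gradient_def, rule_format, OF assms(2) L2_curve_line[OF assms(3,4)],
      of 0] by simp

text \<open>Constant fields belong to \<open>L2 \<mu>\<close> because \<open>\<mu>\<close> is
  finite, so each coordinate of the pulled-back gradient is one of the pairings known to be
  integrable.\<close>

lemma gradient_measurable:
  assumes "is_gradient F G" "\<mu> \<in> P2" "S \<in> L2 \<mu>"
  shows "(\<lambda>x. G (push S \<mu>) (S x)) \<in> borel_measurable \<mu>"
proof (subst borel_measurable_euclidean_space, intro ballI)
  fix b :: 'a
  have "(\<lambda>_. b) \<in> L2 \<mu>"
    by (rule L2_bounded[OF P2_finite_measure[OF assms(2)], where B = "norm b"]) auto
  from gradient_inner_integrable[OF assms this]
  show "(\<lambda>x. G (push S \<mu>) (S x) \<bullet> b) \<in> borel_measurable \<mu>"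
    by (rule borel_measurable_integrable)
qed

text \<open>The truncations \<open>h k\<close> are bounded, hence admissible directions. A step of
  size \<open>1 / L\<close> along \<open>- h k\<close> lowers \<open>F\<close> by at least
  \<open>1 / (2 * L)\<close> times the squared norm of \<open>h k\<close>, and this decrease cannot
  exceed \<open>F (push S \<mu>) - m\<close>. The resulting bound \<open>B\<close> does not depend
  on \<open>k\<close>, so Fatou's lemma carries it over to the gradient itself.\<close>

lemma gradient_L2:
  assumes grad: "is_gradient F G" and "L > 0" and smooth: "transport_smooth L F G"
    and lower: "\<And>\<nu>. \<nu> \<in> P2 \<Longrightarrow> m \<le> F \<nu>" and \<mu>: "\<mu> \<in> P2" and S: "S \<in> L2 \<mu>"
  shows "(\<lambda>x. G (push S \<mu>) (S x)) \<in> L2 \<mu>"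
proof -
  define g where "g = (\<lambda>x. G (push S \<mu>) (S x))"
  define h where "h = (\<lambda>k x. if norm (g x) \<le> real k then g x else 0)"
  define B where "B = 2 * L * (F (push S \<mu>) - m)"
  have g_meas [measurable]: "g \<in> borel_measurable \<mu>"
    unfolding g_def by (rule gradient_measurable[OF grad \<mu> S])
  have h_L2: "h k \<in> L2 \<mu>" for k
    by (rule L2_bounded[OF P2_finite_measure[OF \<mu>], where B = "real k"]) (auto simp: h_def)
  have bound: "(\<integral>x. (norm (h k x))\<^sup>2 \<partial>\<mu>) \<le> B" for k
  proof -
    define T where "T = (\<lambda>x. S x - (1 / L) *\<^sub>R h k x)"
    have T: "T \<in> L2 \<mu>"
      unfolding T_def by (intro L2_diff L2_scaleR S h_L2)
    have "m \<le> F (push T \<mu>)"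
      by (intro lower push_in_P2 \<mu> T)
    moreover have "F (push T \<mu>) - F (push S \<mu>) \<le> (\<integral>x. g x \<bullet> (T x - S x) \<partial>\<mu>)
        + L / 2 * (\<integral>x. (norm (T x - S x))\<^sup>2 \<partial>\<mu>)"
      using smooth \<mu> S T unfolding transport_smooth_def g_def by blast
    \<comment> \<open>Truncation sets large values to 0 instead of rescaling them, so
      \<open>g x \<bullet> h k x\<close> is exactly the squared norm of
      \<open>h k x\<close>.\<close>
    moreover have "g x \<bullet> (T x - S x) = - (1 / L) * (norm (h k x))\<^sup>2" for x
      by (auto simp: T_def h_def power2_norm_eq_inner)
    moreover have "(norm (T x - S x))\<^sup>2 = (1 / L)\<^sup>2 * (norm (h k x))\<^sup>2" for x
      by (simp add: T_def power_mult_distrib power_divide)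
    ultimately have "m - F (push S \<mu>) \<le> - (1 / L) * (\<integral>x. (norm (h k x))\<^sup>2 \<partial>\<mu>)
        + L / 2 * ((1 / L)\<^sup>2 * (\<integral>x. (norm (h k x))\<^sup>2 \<partial>\<mu>))"
      by simp
    then show ?thesis
      using \<open>L > 0\<close> unfolding B_def by (simp add: field_simps power2_eq_square)
  qed
  have "(\<integral>\<^sup>+x. ennreal ((norm (g x))\<^sup>2) \<partial>\<mu>) \<le> ennreal B"
  proof -
    have lim: "(\<lambda>k. ennreal ((norm (h k x))\<^sup>2)) \<longlonglongrightarrow> ennreal ((norm (g x))\<^sup>2)" for x
    proof (rule tendsto_eventually)
      obtain N :: nat where "norm (g x) \<le> real N"
        using real_arch_simple by blast
      then show "\<forall>\<^sub>F k in sequentially. ennreal ((norm (h k x))\<^sup>2) = ennreal ((norm (g x))\<^sup>2)"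
        by (auto simp: h_def eventually_sequentially intro!: exI[of _ N])
    qed
    have "(\<integral>\<^sup>+x. ennreal ((norm (g x))\<^sup>2) \<partial>\<mu>)
        = (\<integral>\<^sup>+x. liminf (\<lambda>k. ennreal ((norm (h k x))\<^sup>2)) \<partial>\<mu>)"
      by (intro nn_integral_cong, rule sym, rule lim_imp_Liminf) (simp, rule lim)
    also have "\<dots> \<le> liminf (\<lambda>k. \<integral>\<^sup>+x. ennreal ((norm (h k x))\<^sup>2) \<partial>\<mu>)"
      by (intro nn_integral_liminf) (auto simp: h_def)
    also have "\<dots> \<le> liminf (\<lambda>k. ennreal B)"
      by (intro Liminf_mono always_eventually allI)
        (simp add: nn_integral_eq_integral L2_integrable[OF h_L2] bound ennreal_leI)
    finally show ?thesis by (simp add: Liminf_const)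
  qed
  then have "integrable \<mu> (\<lambda>x. (norm (g x))\<^sup>2)"
    by (intro integrableI_bounded) (auto intro: le_less_trans)
  then have "g \<in> L2 \<mu>"
    by (simp add: L2_def)
  then show ?thesis by (simp add: g_def)
qed

section \<open>Decay of the energy in one step\<close>

text \<open>Convexity at \<open>X\<close> is tested against \<open>Y\<close> with weight
  \<open>a\<close> and against the comparison map \<open>W\<close> with weight
  \<open>a' - a\<close>; smoothness is applied to the step from \<open>X\<close> to
  \<open>Y'\<close> with weight \<open>a'\<close>. The inner products that remain cancel the cross
  term in the expansion of the squared distance from \<open>Z'\<close> to \<open>W\<close>.\<close>

lemma accelerated_energy_step:
  assumes "transport_convex F G" "transport_smooth L F G" and "\<mu> \<in> P2" and "L > 0"
    and X: "X \<in> L2 \<mu>" and Y: "Y \<in> L2 \<mu>" and Z: "Z \<in> L2 \<mu>" and W: "W \<in> L2 \<mu>"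
    and g: "g \<in> L2 \<mu>" and g_eq: "\<And>x. g x = G (push X \<mu>) (X x)"
    and a: "a \<ge> 0" "a' \<ge> a" "(a' - a)\<^sup>2 \<le> a' / L"
    and X_eq: "\<And>x. a' *\<^sub>R X x = a *\<^sub>R Y x + (a' - a) *\<^sub>R Z x"
    and Z'_eq: "\<And>x. Z' x = Z x - (a' - a) *\<^sub>R g x"
    and Y'_eq: "\<And>x. Y' x = X x - (1 / L) *\<^sub>R g x"
  shows "a' * (F (push Y' \<mu>) - F (push W \<mu>)) + 1 / 2 * (\<integral>x. (norm (Z' x - W x))\<^sup>2 \<partial>\<mu>)
       \<le> a * (F (push Y \<mu>) - F (push W \<mu>)) + 1 / 2 * (\<integral>x. (norm (Z x - W x))\<^sup>2 \<partial>\<mu>)"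
proof -
  define \<alpha> where "\<alpha> = a' - a"
  define N where "N = (\<integral>x. (norm (g x))\<^sup>2 \<partial>\<mu>)"
  define P where "P = (\<integral>x. g x \<bullet> (Z x - W x) \<partial>\<mu>)"
  define PY where "PY = (\<integral>x. g x \<bullet> (Y x - X x) \<partial>\<mu>)"
  define PW where "PW = (\<integral>x. g x \<bullet> (W x - X x) \<partial>\<mu>)"
  have Y': "Y' \<in> L2 \<mu>"
    unfolding Y'_eq[abs_def] by (intro L2_diff L2_scaleR X g)
  have "N \<ge> 0" by (simp add: N_def)
  have conv: "F (push T \<mu>) - F (push X \<mu>) \<ge> (\<integral>x. g x \<bullet> (T x - X x) \<partial>\<mu>)" if "T \<in> L2 \<mu>" for T
    using assms(1,3) X that unfolding transport_convex_def g_eq by blast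
  have cY: "F (push Y \<mu>) - F (push X \<mu>) \<ge> PY" and cW: "F (push W \<mu>) - F (push X \<mu>) \<ge> PW"
    unfolding PY_def PW_def using conv Y W by blast+
  have "F (push Y' \<mu>) - F (push X \<mu>) \<le> (\<integral>x. g x \<bullet> (Y' x - X x) \<partial>\<mu>)
      + L / 2 * (\<integral>x. (norm (Y' x - X x))\<^sup>2 \<partial>\<mu>)"
    using assms(2,3) X Y' unfolding transport_smooth_def g_eq by blast
  also have "\<dots> = - (1 / L) * N + L / 2 * ((1 / L)\<^sup>2 * N)"
  proof -
    have "g x \<bullet> (Y' x - X x) = - (1 / L) * (norm (g x))\<^sup>2" for x
      by (simp add: Y'_eq power2_norm_eq_inner)
    moreover have "(norm (Y' x - X x))\<^sup>2 = (1 / L)\<^sup>2 * (norm (g x))\<^sup>2" for x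
      by (simp add: Y'_eq power_mult_distrib power_divide)
    ultimately show ?thesis by (simp add: N_def)
  qed
  also have "\<dots> = - N / (2 * L)"
    using \<open>L > 0\<close> by (simp add: field_simps power2_eq_square)
  finally have sm: "F (push Y' \<mu>) - F (push X \<mu>) \<le> - N / (2 * L)" .
  \<comment> \<open>Since \<open>X\<close> is the mean of \<open>Y\<close> and \<open>Z\<close> with
    weights \<open>a\<close> and \<open>\<alpha>\<close>, the weighted displacements from
    \<open>X\<close> to \<open>Y\<close> and \<open>W\<close> add up to \<open>\<alpha>\<close>
    times the displacement from \<open>Z\<close> to \<open>W\<close>.\<close>
  have "a * PY + \<alpha> * PW
      = (\<integral>x. a * (g x \<bullet> (Y x - X x)) + \<alpha> * (g x \<bullet> (W x - X x)) \<partial>\<mu>)"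
    unfolding PY_def PW_def
    by (subst Bochner_Integration.integral_add)
      (auto intro!: L2_inner_integrable L2_diff X Y W g)
  also have "\<dots> = (\<integral>x. - \<alpha> * (g x \<bullet> (Z x - W x)) \<partial>\<mu>)"
  proof (rule Bochner_Integration.integral_cong[OF refl])
    fix x
    have "a *\<^sub>R (Y x - X x) + \<alpha> *\<^sub>R (W x - X x) = - \<alpha> *\<^sub>R (Z x - W x)"
      using X_eq[of x] by (simp add: \<alpha>_def algebra_simps)
    then have "g x \<bullet> (a *\<^sub>R (Y x - X x) + \<alpha> *\<^sub>R (W x - X x)) = g x \<bullet> (- \<alpha> *\<^sub>R (Z x - W x))"
      by (rule arg_cong)
    then show "a * (g x \<bullet> (Y x - X x)) + \<alpha> * (g x \<bullet> (W x - X x)) = - \<alpha> * (g x \<bullet> (Z x - W x))"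
      by (simp only: inner_add_right inner_scaleR_right)
  qed
  finally have lin: "a * PY + \<alpha> * PW = - \<alpha> * P"
    by (simp add: P_def)
  have "(\<integral>x. (norm (Z' x - W x))\<^sup>2 \<partial>\<mu>)
      = (\<integral>x. (norm (Z x - W x))\<^sup>2 + (- 2 * \<alpha> * (g x \<bullet> (Z x - W x)) + \<alpha>\<^sup>2 * (norm (g x))\<^sup>2) \<partial>\<mu>)"
  proof (rule Bochner_Integration.integral_cong[OF refl])
    fix x
    have "Z' x - W x = (Z x - W x) - \<alpha> *\<^sub>R g x"
      by (simp add: Z'_eq \<alpha>_def)
    moreover have "(norm (u - \<alpha> *\<^sub>R v))\<^sup>2
        = (norm u)\<^sup>2 + (- 2 * \<alpha> * (v \<bullet> u) + \<alpha>\<^sup>2 * (norm v)\<^sup>2)" for u v :: 'a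
      by (simp add: power2_norm_eq_inner inner_diff_left inner_diff_right inner_commute)
        (simp add: power2_eq_square)
    ultimately show "(norm (Z' x - W x))\<^sup>2
        = (norm (Z x - W x))\<^sup>2 + (- 2 * \<alpha> * (g x \<bullet> (Z x - W x)) + \<alpha>\<^sup>2 * (norm (g x))\<^sup>2)"
      by (simp only:)
  qed
  also have "\<dots> = (\<integral>x. (norm (Z x - W x))\<^sup>2 \<partial>\<mu>) + (- 2 * \<alpha> * P + \<alpha>\<^sup>2 * N)"
    unfolding P_def N_def
    by (subst Bochner_Integration.integral_add
        | intro Bochner_Integration.integrable_add integrable_mult_right L2_integrable
          L2_inner_integrable L2_diff Z W g | simp)+
  finally have dist: "(\<integral>x. (norm (Z' x - W x))\<^sup>2 \<partial>\<mu>)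
      = (\<integral>x. (norm (Z x - W x))\<^sup>2 \<partial>\<mu>) + (- 2 * \<alpha> * P + \<alpha>\<^sup>2 * N)" .
  \<comment> \<open>The weights satisfy \<open>a + \<alpha> = a'\<close>, so
    \<open>F (push X \<mu>)\<close> drops out at the end.\<close>
  have "a * PY + \<alpha> * PW + a' * (F (push Y' \<mu>) - F (push X \<mu>))
      \<le> a * (F (push Y \<mu>) - F (push X \<mu>)) + \<alpha> * (F (push W \<mu>) - F (push X \<mu>))
        + a' * (- N / (2 * L))"
    using a by (intro add_mono mult_left_mono cY cW sm) (auto simp: \<alpha>_def)
  \<comment> \<open>The quadratic remainder of the distance is absorbed by the descent
    \<open>a' * N / (2 * L)\<close>.\<close>
  moreover have "\<alpha>\<^sup>2 * N \<le> a' / L * N"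
    using a(3) \<open>N \<ge> 0\<close> by (intro mult_right_mono) (auto simp: \<alpha>_def)
  ultimately show ?thesis
    unfolding dist lin by (simp add: \<alpha>_def algebra_simps)
qed

section \<open>The convergence rate\<close>

theorem theorem5p5:
  fixes F :: "(real ^ 'd) measure \<Rightarrow> real"
    and G :: "(real ^ 'd) measure \<Rightarrow> real ^ 'd \<Rightarrow> real ^ 'd"
    and L :: real
    and \<mu>0 \<mu>star :: "(real ^ 'd) measure"
    and Xstar :: "real ^ 'd \<Rightarrow> real ^ 'd"
    and a :: "nat \<Rightarrow> real"
    and X Y Z :: "nat \<Rightarrow> real ^ 'd \<Rightarrow> real ^ 'd"
  assumes "is_gradient F G"
    and "L > 0"
    and "transport_convex F G"
    and "transport_smooth L F G"
    and "\<mu>star \<in> P2"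
    and "\<And>\<nu>. \<nu> \<in> P2 \<Longrightarrow> F \<mu>star \<le> F \<nu>"
    and "\<mu>0 \<in> P2"
    and "Xstar \<in> L2 \<mu>0"
    and "\<mu>star = push Xstar \<mu>0"
    and "\<And>n. a n = (real n + 1) * (real n + 2) / (16 * L)"
    and "\<And>x. X 0 x = x"
    and "\<And>x. Y 0 x = x"
    and "\<And>x. Z 0 x = x"
    and "\<And>n x. X (Suc n) x = Y n x + ((a (Suc n) - a n) / a (Suc n)) *\<^sub>R (Z n x - Y n x)"
    and "\<And>n x. Z (Suc n) x = Z n x - (a (Suc n) - a n) *\<^sub>R G (push (X (Suc n)) \<mu>0) (X (Suc n) x)"
    and "\<And>n x. Y (Suc n) x = X (Suc n) x - (1 / L) *\<^sub>R G (push (X (Suc n)) \<mu>0) (X (Suc n) x)"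
  shows "(\<lambda>n. F (push (Y n) \<mu>0) - F \<mu>star) \<in> O(\<lambda>n. 1 / (real n)\<^sup>2)"
proof -
  note grad = assms(1) and L_pos = assms(2) and smooth = assms(4) and lower = assms(6)
    and \<mu>0 = assms(7) and Xstar = assms(8) and \<mu>star_eq = assms(9)
    and a_eq = assms(10) and X0 = assms(11) and Y0 = assms(12) and Z0 = assms(13)
    and X_Suc = assms(14) and Z_Suc = assms(15) and Y_Suc = assms(16)
  define g where "g = (\<lambda>n x. G (push (X n) \<mu>0) (X n x))"
  have g_L2: "g n \<in> L2 \<mu>0" if "X n \<in> L2 \<mu>0" for n
    unfolding g_def by (rule gradient_L2[OF grad L_pos smooth lower \<mu>0 that])
  have X_Suc_L2: "X (Suc n) \<in> L2 \<mu>0" if "Y n \<in> L2 \<mu>0" "Z n \<in> L2 \<mu>0" for n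
    unfolding X_Suc[abs_def] by (intro L2_add L2_scaleR L2_diff that)
  \<comment> \<open>Each \<open>X (Suc n)\<close> is a combination of \<open>Y n\<close> and
    \<open>Z n\<close>, so the induction can run on these two alone and obtain the gradient at
    \<open>X (Suc n)\<close> on the way.\<close>
  have YZ: "Y n \<in> L2 \<mu>0 \<and> Z n \<in> L2 \<mu>0" for n
  proof (induction n)
    case 0
    show ?case
      unfolding Y0[abs_def] Z0[abs_def] using L2_id[OF \<mu>0] by simp
  next
    case (Suc n)
    then have X': "X (Suc n) \<in> L2 \<mu>0" by (simp add: X_Suc_L2)
    note g' = g_L2[OF X', unfolded g_def]
    show ?case
      unfolding Y_Suc[abs_def] Z_Suc[abs_def]
      by (intro conjI L2_diff L2_scaleR X' g' Suc.IH[THEN conjunct2])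
  qed
  define E where "E = (\<lambda>n. a n * (F (push (Y n) \<mu>0) - F \<mu>star)
      + 1 / 2 * (\<integral>x. (norm (Z n x - Xstar x))\<^sup>2 \<partial>\<mu>0))"
  have a_pos: "a n > 0" for n
    using L_pos by (simp add: a_eq)
  have a_diff: "a (Suc n) - a n = (real n + 2) / (8 * L)" for n
    using L_pos by (simp add: a_eq field_simps)
  have E_step: "E (Suc n) \<le> E n" for n
    \<comment> \<open>Writing \<open>\<mu>star\<close> as a push-forward of \<open>\<mu>0\<close>
      lets \<open>Xstar\<close> serve as the comparison map \<open>W\<close>.\<close>
    unfolding E_def \<mu>star_eq
  proof (rule accelerated_energy_step[OF assms(3) smooth \<mu>0 L_pos, where X = "X (Suc n)"])
    show X': "X (Suc n) \<in> L2 \<mu>0" using YZ by (intro X_Suc_L2) auto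
    show "g (Suc n) \<in> L2 \<mu>0" using X' by (rule g_L2)
    show "a n \<ge> 0" using a_pos[of n] by simp
    have "a (Suc n) - a n \<ge> 0" using L_pos by (simp add: a_diff)
    then show "a (Suc n) \<ge> a n" by simp
    \<comment> \<open>Both sides of the step-size condition over the denominator
      \<open>64 * L\<^sup>2\<close>; what remains is \<open>n + 2 \<le> 4 * (n + 3)\<close>.\<close>
    have "(real n + 2)\<^sup>2 / (64 * L\<^sup>2) \<le> 4 * ((real n + 2) * (real n + 3)) / (64 * L\<^sup>2)"
      by (intro divide_right_mono) (auto simp: power2_eq_square algebra_simps)
    also have "\<dots> = a (Suc n) / L"
      by (simp add: a_eq power2_eq_square add.commute)
    finally show "(a (Suc n) - a n)\<^sup>2 \<le> a (Suc n) / L"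
      by (simp add: a_diff power_divide power_mult_distrib)
    show "a (Suc n) *\<^sub>R X (Suc n) x = a n *\<^sub>R Y n x + (a (Suc n) - a n) *\<^sub>R Z n x" for x
    proof -
      have "a (Suc n) *\<^sub>R X (Suc n) x
          = a (Suc n) *\<^sub>R Y n x + (a (Suc n) - a n) *\<^sub>R (Z n x - Y n x)"
        using a_pos[of "Suc n"] by (simp add: X_Suc scaleR_add_right)
      then show ?thesis by (simp add: algebra_simps)
    qed
  qed (use YZ Xstar in \<open>auto simp: g_def Z_Suc Y_Suc\<close>)
  have E_le: "E n \<le> E 0" for n
    using E_step by (rule lift_Suc_antimono_le) simp
  have gap_nonneg: "F (push (Y n) \<mu>0) - F \<mu>star \<ge> 0" for n
    using lower[OF push_in_P2[OF \<mu>0]] YZ by simp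
  have "norm (F (push (Y n) \<mu>0) - F \<mu>star) \<le> (16 * L * E 0) * norm (1 / (real n)\<^sup>2)"
    if "n > 0" for n
  proof -
    let ?d = "F (push (Y n) \<mu>0) - F \<mu>star"
    \<comment> \<open>The quadratic growth of the weights turns the bounded energy into the rate;
      the distance term of \<open>E n\<close> is nonnegative and is dropped.\<close>
    have "(real n)\<^sup>2 / (16 * L) \<le> a n"
      unfolding a_eq using L_pos
      by (intro divide_right_mono) (auto simp: power2_eq_square algebra_simps)
    then have "(real n)\<^sup>2 / (16 * L) * ?d \<le> a n * ?d"
      using gap_nonneg by (rule mult_right_mono)
    also have "\<dots> \<le> E n" by (simp add: E_def)
    also have "\<dots> \<le> E 0" by (rule E_le)
    finally show ?thesis
      using L_pos that gap_nonneg[of n] by (simp add: field_simps)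
  qed
  then show ?thesis
    by (intro bigoI[where c = "16 * L * E 0"] eventually_mono[OF eventually_gt_at_top[of 0]])
qed

end
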